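(* Let $1\le n\le p$ be integers, let $X\in\mathbb{R}^{n\times p}$ be a matrix of full rank $n$, let $\beta^\star\in\mathbb{R}^p$, $\varepsilon\in\mathbb{R}^n$, $y=X\beta^\star+\varepsilon$, and let $\lambda_n^0\in\mathbb{R}$ be such that $\|X^\top\varepsilon\|_{\ell_\infty}\le\lambda_n^0$. (i) Assume that $X$ satisfies $\mathrm{UDP}(S_0,\kappa_0,\Delta)$, where $1\le S_0\le p$ and $0<\kappa_0<1/2$. Let $\lambda_\ell>0$ satisfy $\lambda_\ell>\lambda_n^0/(1-2\kappa_0)$, and let $\beta^\ell$ be a lasso estimator with parameter $\lambda_\ell$. Then $$\|\beta^\ell-\beta^\star\|_{\ell_1}\le\frac{2}{\big(1-\frac{\lambda_n^0}{\lambda_\ell}\big)-2\kappa_0}\ \min_{\mathcal S}\Big(\lambda_\ell\,\Delta^2\,s+\|\beta^\star_{\mathcal S^c}\|_{\ell_1}\Big),$$ where the minimum is over all $\mathcal S\subseteq\{1,\dots,p\}$ with $|\mathcal S|=s$, $1\le s\le S_0$. (ii) Let $\rho_n>0$ be the smallest singular value of $X$ and $\delta$ the distortion of $\ker(X)$ (with no UDP assumption). For all $0<\kappa_0<1/2$, all $\lambda_\ell>0$ with $\lambda_\ell>\lambda_n^0/(1-2\kappa_0)$, every lasso estimator $\beta^\ell$ with parameter $\lambda_\ell$, and every $\mathcal S\subseteq\{1,\dots,p\}$ with $|\mathcal S|=s$, $1\le s\le(\kappa_0/\delta)^2p$, $$\|\beta^\ell-\beta^\star\|_{\ell_1}\le\frac{2}{\big(1-\frac{\lambda_n^0}{\lambda_\ell}\big)-2\kappa_0}\Big(\lambda_\ell\cdot\frac{4\,\delta^2}{\rho_n^2}\cdot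 s+\|\beta^\star_{\mathcal S^c}\|_{\ell_1}\Big)$$ (i.e. the bound holds with the minimum over all such $\mathcal S$ on the right-hand side).
   Context: For $x\in\mathbb{R}^m$, $\|x\|_{\ell_1}=\sum_i|x_i|$, $\|x\|_{\ell_2}=(\sum_i x_i^2)^{1/2}$, $\|x\|_{\ell_\infty}=\max_i|x_i|$. For $\gamma\in\mathbb{R}^p$ and $\mathcal S\subseteq\{1,\dots,p\}$, $\gamma_{\mathcal S}\in\mathbb{R}^p$ is the vector with $(\gamma_{\mathcal S})_i=\gamma_i$ if $i\in\mathcal S$ and $0$ otherwise; $\mathcal S^c=\{1,\dots,p\}\setminus\mathcal S$. The singular values of the rank-$n$ matrix $X$ ($n\le p$) are $\rho_1\ge\dots\ge\rho_n>0$. Lasso estimator with parameter $\lambda_\ell>0$: any $$\beta^\ell\in\arg\min_{\beta\in\mathbb{R}^p}\Big\{\tfrac12\|X\beta-y\|_{\ell_2}^2+\lambda_\ell\|\beta\|_{\ell_1}\Big\}.$$ Universal Distortion Property: for $1\le S_0\le p$, $0<\kappa_0<1/2$ and $\Delta>0$, $X$ satisfies $\mathrm{UDP}(S_0,\kappa_0,\Delta)$ if for all $\gamma\in\mathbb{R}^p$, all integers $s$ with $1\le s\le S_0$, and all $\mathcal S\subseteq\{1,\dots,p\}$ with $|\mathcal S|=s$, $$\|\gamma_{\mathcal S}\|_{\ell_1}\le\Delta\sqrt s\,\|X\gamma\|_{\ell_2}+\kappa_0\|\gamma\|_{\ell_1}.$$ A subspace $\Gamma\subset\mathbb{R}^p$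 has distortion $\delta$, with $1\le\delta\le\sqrt p$, if $\|x\|_{\ell_1}\le\sqrt p\,\|x\|_{\ell_2}\le\delta\,\|x\|_{\ell_1}$ for all $x\in\Gamma$. "The distortion" of $\Gamma$ is the smallest such $\delta$, i.e. $\delta=\sup_{x\in\Gamma\setminus\{0\}}\sqrt p\,\|x\|_{\ell_2}/\|x\|_{\ell_1}$ (and $\delta=1$ if $\Gamma=\{0\}$). *)

theory Defs
  imports "HOL-Analysis.Analysis"
begin

definition l1norm :: "real^'m \<Rightarrow> real" where
  "l1norm x = (\<Sum>i\<in>UNIV. \<bar>x $ i\<bar>)"

definition vec_restrict :: "real^'p \<Rightarrow> 'p set \<Rightarrow> real^'p" where
  "vec_restrict g S = (\<chi> i. if i \<in> S then g $ i else 0)"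

definition lasso_estimator :: "real^'p^'n \<Rightarrow> real^'n \<Rightarrow> real \<Rightarrow> real^'p \<Rightarrow> bool" where
  "lasso_estimator X y lam b \<longleftrightarrow>
     is_arg_min (\<lambda>\<beta>. 1/2 * (norm (X *v \<beta> - y))\<^sup>2 + lam * l1norm \<beta>) (\<lambda>_. True) b"

definition UDP :: "real^'p^'n \<Rightarrow> nat \<Rightarrow> real \<Rightarrow> real \<Rightarrow> bool" where
  "UDP X S0 \<kappa> \<Delta> \<longleftrightarrow>
     (\<forall>\<gamma>. \<forall>s. 1 \<le> s \<and> s \<le> S0 \<longrightarrow> (\<forall>S. card S = s \<longrightarrow>
        l1norm (vec_restrict \<gamma> S) \<le> \<Delta> * sqrt (real s) * norm (X *v \<gamma>) + \<kappa> * l1norm \<gamma>))"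

definition has_distortion :: "(real^'p) set \<Rightarrow> real \<Rightarrow> bool" where
  "has_distortion G d \<longleftrightarrow> 1 \<le> d \<and> d \<le> sqrt (real CARD('p)) \<and>
     (\<forall>x\<in>G. l1norm x \<le> sqrt (real CARD('p)) * norm x \<and>
             sqrt (real CARD('p)) * norm x \<le> d * l1norm x)"

definition distortion :: "(real^'p) set \<Rightarrow> real" where
  "distortion G = (LEAST d. has_distortion G d)"

(* The value 0 belongs to this set iff the left and the right kernel are both
   nontrivial, i.e. iff rank X < min n p; so for a matrix of full rank n <= p
   these are exactly its n (positive) singular values, without multiplicity. *)
definition singular_values :: "real^'p^'n \<Rightarrow> real set" where
  "singular_values X = {\<sigma>. 0 \<le> \<sigma> \<and> (\<exists>u v. norm u = 1 \<and> norm v = 1 \<and>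
      X *v v = \<sigma> *\<^sub>R u \<and> transpose X *v u = \<sigma> *\<^sub>R v)}"

definition min_singular_value :: "real^'p^'n \<Rightarrow> real" where
  "min_singular_value X = Min (singular_values X)"

text \<open>Well-definedness of \<open>distortion\<close> and \<open>min_singular_value\<close>: the least element
  and the minimum exist.\<close>

lemma l1norm_nonneg: "0 \<le> l1norm x"
  by (simp add: l1norm_def sum_nonneg)

lemma l1norm_eq_0: "l1norm x = 0 \<longleftrightarrow> x = 0"
  by (simp add: l1norm_def sum_nonneg_eq_0_iff vec_eq_iff)

lemma norm_le_l1norm: "norm x \<le> l1norm x"
  by (simp add: l1norm_def norm_le_l1_cart)

lemma l1norm_le_norm:
  fixes x :: "real^'p"
  shows "l1norm x \<le> sqrt (real CARD('p)) * norm x"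
proof -
  have "l1norm x \<le> L2_set (\<lambda>i. \<bar>x $ i\<bar>) UNIV * L2_set (\<lambda>_. 1) (UNIV :: 'p set)"
    unfolding l1norm_def using L2_set_mult_ineq[of "\<lambda>i. \<bar>x $ i\<bar>" "\<lambda>_. 1" UNIV] by simp
  then show ?thesis
    by (simp add: norm_vec_def L2_set_def mult.commute)
qed

lemma
  fixes G :: "(real^'p) set"
  shows has_distortion_distortion: "has_distortion G (distortion G)"
    and distortion_le: "has_distortion G d \<Longrightarrow> distortion G \<le> d"
    and distortion_eq_Sup: "\<And>x. x \<in> G \<Longrightarrow> x \<noteq> 0 \<Longrightarrow>
      distortion G = (SUP x\<in>G - {0}. sqrt (real CARD('p)) * norm x / l1norm x)"
    and distortion_zero: "G \<subseteq> {0} \<Longrightarrow> distortion G = 1"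
proof -
  let ?q = "\<lambda>x::real^'p. sqrt (real CARD('p)) * norm x / l1norm x"
  define D where "D = (if G - {0} = {} then 1 else SUP x\<in>G - {0}. ?q x)"
  have pos: "0 < l1norm x" if "x \<noteq> 0" for x :: "real^'p"
    using that l1norm_nonneg[of x] l1norm_eq_0[of x] by linarith
  have q1: "1 \<le> ?q x" and q2: "?q x \<le> sqrt (real CARD('p))" if "x \<noteq> 0" for x
    using pos[OF that] l1norm_le_norm[of x] norm_le_l1norm[of x]
    by (auto simp: divide_simps mult_left_mono)
  have bdd: "bdd_above (?q ` (G - {0}))"
    using q2 by (intro bdd_aboveI[where M = "sqrt (real CARD('p))"]) auto
  have has: "has_distortion G D"
  proof -
    have 1: "1 \<le> sqrt (real CARD('p))" by (simp add: Suc_leI)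
    have le: "?q x \<le> D" if "x \<in> G" "x \<noteq> 0" for x
      using that cSUP_upper[OF _ bdd, of x] by (auto simp: D_def)
    have "1 \<le> D"
    proof (cases "G - {0} = {}")
      case False
      then obtain x where x: "x \<in> G" "x \<noteq> 0" by auto
      show ?thesis using le[OF x] q1[OF x(2)] by linarith
    qed (simp add: D_def)
    moreover have "D \<le> sqrt (real CARD('p))"
      using 1 q2 by (auto simp: D_def intro!: cSUP_least)
    moreover have "sqrt (real CARD('p)) * norm x \<le> D * l1norm x" if "x \<in> G" for x
    proof (cases "x = 0")
      case False
      then show ?thesis using le[OF that False] pos[OF False] by (simp add: pos_divide_le_eq)
    qed (simp add: l1norm_def)
    ultimately show ?thesis
      by (auto simp: has_distortion_def l1norm_le_norm)
  qed
  have least: "D \<le> d" if "has_distortion G d" for d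
  proof (cases "G - {0} = {}")
    case True
    then show ?thesis using that by (simp add: D_def has_distortion_def)
  next
    case False
    have "?q x \<le> d" if "x \<in> G - {0}" for x
      using \<open>has_distortion G d\<close> that pos[of x]
      by (auto simp: has_distortion_def pos_divide_le_eq)
    then show ?thesis using False by (auto simp: D_def intro!: cSUP_least)
  qed
  have eq: "distortion G = D"
    unfolding distortion_def using has least by (intro Least_equality) auto
  show "has_distortion G (distortion G)" using has eq by simp
  show "has_distortion G d \<Longrightarrow> distortion G \<le> d" using least eq by simp
  show "distortion G = (SUP x\<in>G - {0}. ?q x)" if "x \<in> G" "x \<noteq> 0" for x
    using that unfolding eq D_def by auto
  show "G \<subseteq> {0} \<Longrightarrow> distortion G = 1" unfolding eq D_def by auto
qed

lemma finite_singular_values: "finite (singular_values (X :: real^'p^'n))"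
proof -
  have "\<forall>s\<in>singular_values X. \<exists>u. norm u = 1 \<and> X *v (transpose X *v u) = s\<^sup>2 *\<^sub>R u"
    by (auto simp: singular_values_def power2_eq_square)
       (metis matrix_vector_mult_scaleR scaleR_scaleR)
  then obtain U where U: "\<And>s. s \<in> singular_values X \<Longrightarrow> norm (U s) = 1"
    "\<And>s. s \<in> singular_values X \<Longrightarrow> X *v (transpose X *v U s) = s\<^sup>2 *\<^sub>R U s"
    by metis
  have orth: "U s \<bullet> U t = 0"
    if "s \<in> singular_values X" "t \<in> singular_values X" "s \<noteq> t" for s t
  proof -
    have "(X *v (transpose X *v U s)) \<bullet> U t = U s \<bullet> (X *v (transpose X *v U t))"
      by (metis dot_lmul_matrix inner_commute transpose_matrix_vector)
    then have "s\<^sup>2 * (U s \<bullet> U t) = t\<^sup>2 * (U s \<bullet> U t)"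
      using U(2)[OF that(1)] U(2)[OF that(2)] by simp
    moreover have "s\<^sup>2 \<noteq> t\<^sup>2"
      using that by (auto simp: singular_values_def)
    ultimately show ?thesis by simp
  qed
  have inj: "inj_on U (singular_values X)"
  proof (rule inj_onI, rule ccontr)
    fix s t assume st: "s \<in> singular_values X" "t \<in> singular_values X" "U s = U t" "s \<noteq> t"
    then have "U s = 0" using orth[of s t] by simp
    then show False using U(1)[OF st(1)] by simp
  qed
  have "pairwise orthogonal (U ` singular_values X)"
    by (auto simp: pairwise_def orthogonal_def intro!: orth)
  then have "finite (U ` singular_values X)"
    by (rule pairwise_orthogonal_imp_finite)
  then show ?thesis using inj by (rule finite_imageD)
qed

lemma singular_values_pos:
  fixes X :: "real^'p^'n"
  assumes "rank X = CARD('n)" and s: "s \<in> singular_values X"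
  shows "0 < s"
proof -
  obtain u v where uv: "0 \<le> s" "norm u = 1" "transpose X *v u = s *\<^sub>R v"
    using s by (auto simp: singular_values_def)
  have "inj ((*v) (transpose X))"
    using assms(1) by (simp add: full_rank_injective[symmetric] rank_transpose)
  then have "transpose X *v u \<noteq> 0"
    using uv(2) by (metis injD matrix_vector_mult_0_right norm_zero zero_neq_one)
  then show ?thesis using uv by (cases "s = 0") auto
qed

lemma singular_values_nonempty:
  fixes X :: "real^'p^'n"
  assumes "rank X = CARD('n)"
  shows "singular_values X \<noteq> {}"
proof -
  let ?T = "\<lambda>u. transpose X *v u"
  have "\<exists>u\<in>sphere 0 1. \<forall>w\<in>sphere 0 1. norm (?T u) \<le> norm (?T w)"
  proof (rule continuous_attains_inf)
    show "sphere (0::real^'n) 1 \<noteq> {}" by simp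
    show "continuous_on (sphere 0 1) (\<lambda>u. norm (?T u))"
      by (intro continuous_on_norm linear_continuous_on) (rule matrix_vector_mul_bounded_linear)
  qed simp
  then obtain u where u: "norm u = 1"
    and min: "\<And>w. norm w = 1 \<Longrightarrow> norm (?T u) \<le> norm (?T w)"
    by (auto simp: dist_norm)
  define m where "m = norm (?T u)"
  have ge: "m\<^sup>2 * (norm w)\<^sup>2 \<le> (norm (?T w))\<^sup>2" for w
  proof (cases "w = 0")
    case False
    have "m \<le> norm (?T ((1 / norm w) *\<^sub>R w))"
      unfolding m_def using False by (intro min) simp
    then have "m * norm w \<le> norm (?T w)"
      using False by (simp add: matrix_vector_mult_scaleR divide_simps)
    then show ?thesis
      by (simp add: m_def power_mono flip: power_mult_distrib)
  qed simp
  define g where "g = X *v ?T u - m\<^sup>2 *\<^sub>R u"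
  have "g = 0"
  proof (rule ccontr)
    assume g: "g \<noteq> 0"
    define c where "c = (norm (?T g))\<^sup>2 - m\<^sup>2 * (norm g)\<^sup>2"
    have adj: "?T u \<bullet> ?T g = (X *v ?T u) \<bullet> g"
      by (metis dot_lmul_matrix inner_commute transpose_matrix_vector)
    have quad: "0 \<le> c * t\<^sup>2 - 2 * t * (norm g)\<^sup>2" for t
    proof -
      have 1: "(norm (?T (u - t *\<^sub>R g)))\<^sup>2
          = m\<^sup>2 - 2 * t * ((X *v ?T u) \<bullet> g) + t\<^sup>2 * (norm (?T g))\<^sup>2"
        unfolding m_def adj[symmetric] matrix_vector_mult_diff_distrib matrix_vector_mult_scaleR
          power2_norm_eq_inner
        by (simp only: inner_diff_left inner_diff_right inner_scaleR_left inner_scaleR_right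
            inner_commute[of "?T g" "?T u"] power2_eq_square) (simp add: algebra_simps)
      have 2: "(norm (u - t *\<^sub>R g))\<^sup>2 = 1 - 2 * t * (u \<bullet> g) + t\<^sup>2 * (norm g)\<^sup>2"
        using u unfolding power2_norm_eq_inner norm_eq_1
        by (simp add: inner_diff_left inner_diff_right inner_commute
            power2_eq_square algebra_simps)
      have 3: "(X *v ?T u) \<bullet> g = (norm g)\<^sup>2 + m\<^sup>2 * (u \<bullet> g)"
        by (simp add: g_def power2_norm_eq_inner inner_diff_left inner_diff_right algebra_simps)
      show ?thesis using ge[of "u - t *\<^sub>R g"] unfolding 1 2 3 c_def
        by (simp add: algebra_simps)
    qed
    define t where "t = (norm g)\<^sup>2 / (\<bar>c\<bar> + 1)"
    have t: "0 < t" using g by (simp add: t_def add_nonneg_pos)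
    have "2 * (norm g)\<^sup>2 \<le> c * t"
      using quad[of t] t by (simp add: power2_eq_square)
    also have "\<dots> \<le> (\<bar>c\<bar> + 1) * t"
      using t by (intro mult_right_mono) auto
    also have "\<dots> = (norm g)\<^sup>2" by (simp add: t_def)
    finally show False using g by simp
  qed
  then have eig: "X *v ?T u = m\<^sup>2 *\<^sub>R u" by (simp add: g_def)
  have "inj ((*v) (transpose X))"
    using assms by (simp add: full_rank_injective[symmetric] rank_transpose)
  then have "?T u \<noteq> 0"
    using u by (metis injD matrix_vector_mult_0_right norm_zero zero_neq_one)
  then have "0 < m" by (simp add: m_def)
  then have "m \<in> singular_values X"
    unfolding singular_values_def
    using u eig m_def
    by (intro CollectI conjI exI[of _ u] exI[of _ "(1 / m) *\<^sub>R ?T u"])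
       (auto simp: matrix_vector_mult_scaleR power2_eq_square)
  then show ?thesis by blast
qed

lemma min_singular_value:
  fixes X :: "real^'p^'n"
  assumes "rank X = CARD('n)"
  shows "min_singular_value X \<in> singular_values X" "0 < min_singular_value X"
    "s \<in> singular_values X \<Longrightarrow> min_singular_value X \<le> s"
  unfolding min_singular_value_def
  using Min_in[OF finite_singular_values singular_values_nonempty[OF assms]]
    singular_values_pos[OF assms] Min_le[OF finite_singular_values]
  by blast+

end

theory Submission
  imports Defs
begin

text \<open>Write \<open>h = \<beta>l - \<beta>s\<close> for the estimation error. Comparing the lasso objective at \<open>\<beta>l\<close>
  with its value at \<open>\<beta>s\<close> and expanding the square leaves the noise only in the cross term
  \<open>h \<bullet> X\<^sup>T\<epsilon>\<close>, which Hoelder's inequality bounds by \<open>lam0 * \<parallel>h\<parallel>\<^sub>1\<close>. Since the penalty difference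
  \<open>\<parallel>\<beta>s\<parallel>\<^sub>1 - \<parallel>\<beta>l\<parallel>\<^sub>1\<close> pays for \<open>h\<close> off \<open>S\<close> (lemma \<open>l1norm_perturb\<close>), one gets, for every \<open>S\<close>,
  \<open>(1/2) \<parallel>X h\<parallel>\<^sup>2 + (lam - lam0) \<parallel>h\<parallel>\<^sub>1 \<le> 2 lam (\<parallel>h\<^sub>S\<parallel>\<^sub>1 + \<parallel>\<beta>s\<^sub>-\<^sub>S\<parallel>\<^sub>1)\<close>
  (lemma \<open>lasso_basic_inequality\<close>). The universal distortion property replaces \<open>\<parallel>h\<^sub>S\<parallel>\<^sub>1\<close> by
  a multiple of \<open>\<parallel>X h\<parallel>\<close>, which the quadratic term absorbs, and a multiple of \<open>\<parallel>h\<parallel>\<^sub>1\<close>, which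
  the left-hand side absorbs. This is the first part.

  The second part is the first one with \<open>\<Delta> = 2 \<delta> / \<rho>\<close>: lemma \<open>UDP_of_distortion\<close> shows that
  a matrix of full row rank always satisfies the universal distortion property with this constant.
  There a vector is split into its component in the kernel, whose Euclidean norm the
  distortion controls by its \<open>\<ell>\<^sub>1\<close> norm, and its component in the row space, on which \<open>X\<close>
  expands by at least \<open>\<rho>\<close> (lemma \<open>norm_matrix_row_space_ge\<close>).\<close>

section \<open>The \<open>\<ell>\<^sub>1\<close> norm and coordinate restriction\<close>

lemma l1norm_diff_le: "l1norm (x - y) \<le> l1norm x + l1norm y"
  unfolding l1norm_def sum.distrib[symmetric] by (intro sum_mono) auto

lemma l1norm_vec_restrict: "l1norm (vec_restrict x S) = (\<Sum>i\<in>S. \<bar>x $ i\<bar>)"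
  by (simp add: l1norm_def vec_restrict_def if_distrib[of abs] sum.If_cases)

lemma inner_le_infnorm_l1norm:
  fixes x z :: "real^'p"
  shows "x \<bullet> z \<le> infnorm x * l1norm z"
  unfolding inner_vec_def l1norm_def sum_distrib_left
proof (intro sum_mono)
  fix i
  have "x $ i \<bullet> z $ i \<le> \<bar>x $ i\<bar> * \<bar>z $ i\<bar>"
    by (metis abs_ge_self abs_mult inner_real_def)
  also have "\<dots> \<le> infnorm x * \<bar>z $ i\<bar>"
    by (intro mult_right_mono component_le_infnorm_cart) simp
  finally show "x $ i \<bullet> z $ i \<le> infnorm x * \<bar>z $ i\<bar>" .
qed

lemma l1norm_vec_restrict_le_norm:
  fixes x :: "real^'p"
  shows "l1norm (vec_restrict x S) \<le> sqrt (real (card S)) * norm x"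
proof -
  have "l1norm (vec_restrict x S) \<le> L2_set (\<lambda>i. x $ i) S * L2_set (\<lambda>_. 1) S"
    unfolding l1norm_vec_restrict using L2_set_mult_ineq[of "\<lambda>i. x $ i" "\<lambda>_. 1" S] by simp
  also have "L2_set (\<lambda>_. 1) S = sqrt (real (card S))"
    by (simp add: L2_set_def)
  also have "L2_set (\<lambda>i. x $ i) S \<le> norm x"
    unfolding norm_vec_def L2_set_def by (intro real_sqrt_le_mono) (simp add: sum_mono2)
  finally show ?thesis by (simp add: mult_left_mono mult_right_mono mult.commute)
qed

text \<open>In each coordinate \<open>\<bar>b\<bar> - \<bar>b + h\<bar> + \<bar>h\<bar>\<close> is at most both \<open>2 * \<bar>h\<bar>\<close> and \<open>2 * \<bar>b\<bar>\<close>; the first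
  bound is used on \<open>S\<close> and the second one off \<open>S\<close>.\<close>

lemma l1norm_perturb:
  fixes b h :: "real^'p"
  shows "l1norm b - l1norm (b + h) + l1norm h
    \<le> 2 * (l1norm (vec_restrict h S) + l1norm (vec_restrict b (- S)))"
  unfolding l1norm_def sum.distrib[symmetric] sum_subtractf[symmetric] sum_distrib_left
  by (intro sum_mono) (auto simp: vec_restrict_def)

section \<open>The error of the lasso under the universal distortion property\<close>

lemma lasso_basic_inequality:
  fixes X :: "real^'p^'n" and \<beta>s \<beta>l :: "real^'p"
  assumes y: "y = X *v \<beta>s + \<epsilon>"
    and noise: "infnorm (transpose X *v \<epsilon>) \<le> lam0"
    and lam: "0 \<le> lam" and lasso: "lasso_estimator X y lam \<beta>l"
  shows "1/2 * (norm (X *v (\<beta>l - \<beta>s)))\<^sup>2 + (lam - lam0) * l1norm (\<beta>l - \<beta>s)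
    \<le> 2 * lam * (l1norm (vec_restrict (\<beta>l - \<beta>s) S) + l1norm (vec_restrict \<beta>s (- S)))"
proof -
  define h where "h = \<beta>l - \<beta>s"
  have \<beta>l: "\<beta>l = \<beta>s + h" by (simp add: h_def)
  have res: "X *v \<beta>l - y = X *v h - \<epsilon>" "X *v \<beta>s - y = - \<epsilon>"
    by (simp_all add: y \<beta>l matrix_vector_right_distrib)
  have "1/2 * (norm (X *v \<beta>l - y))\<^sup>2 + lam * l1norm \<beta>l
      \<le> 1/2 * (norm (X *v \<beta>s - y))\<^sup>2 + lam * l1norm \<beta>s"
    using lasso unfolding lasso_estimator_def is_arg_min_def by (meson not_less)
  then have "1/2 * (norm (X *v h - \<epsilon>))\<^sup>2 + lam * l1norm (\<beta>s + h)
      \<le> 1/2 * (norm \<epsilon>)\<^sup>2 + lam * l1norm \<beta>s"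
    unfolding res by (simp add: \<beta>l)
  moreover have "(norm (X *v h - \<epsilon>))\<^sup>2 = (norm (X *v h))\<^sup>2 - 2 * ((X *v h) \<bullet> \<epsilon>) + (norm \<epsilon>)\<^sup>2"
    by (simp add: power2_norm_eq_inner inner_diff_left inner_diff_right inner_commute)
  moreover have "(X *v h) \<bullet> \<epsilon> \<le> lam0 * l1norm h"
  proof -
    have "(X *v h) \<bullet> \<epsilon> = (transpose X *v \<epsilon>) \<bullet> h"
      by (metis dot_lmul_matrix inner_commute transpose_matrix_vector)
    also have "\<dots> \<le> infnorm (transpose X *v \<epsilon>) * l1norm h"
      by (rule inner_le_infnorm_l1norm)
    also have "\<dots> \<le> lam0 * l1norm h"
      by (intro mult_right_mono noise l1norm_nonneg)
    finally show ?thesis .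
  qed
  ultimately have "1/2 * (norm (X *v h))\<^sup>2 \<le> lam0 * l1norm h + lam * (l1norm \<beta>s - l1norm (\<beta>s + h))"
    by (simp add: algebra_simps)
  moreover have "lam * (l1norm \<beta>s - l1norm (\<beta>s + h) + l1norm h)
      \<le> lam * (2 * (l1norm (vec_restrict h S) + l1norm (vec_restrict \<beta>s (- S))))"
    by (intro mult_left_mono l1norm_perturb lam)
  ultimately show ?thesis
    unfolding h_def[symmetric] by (simp add: algebra_simps)
qed

lemma lasso_error_le:
  fixes X :: "real^'p^'n" and \<beta>s \<beta>l :: "real^'p"
  assumes y: "y = X *v \<beta>s + \<epsilon>"
    and noise: "infnorm (transpose X *v \<epsilon>) \<le> lam0"
    and \<kappa>: "\<kappa> < 1/2" and lam: "0 < lam" "lam0 / (1 - 2 * \<kappa>) < lam"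
    and lasso: "lasso_estimator X y lam \<beta>l"
    and udp: "UDP X S0 \<kappa> \<Delta>" and S: "1 \<le> card S" "card S \<le> S0"
  shows "l1norm (\<beta>l - \<beta>s) \<le> 2 / ((1 - lam0 / lam) - 2 * \<kappa>) *
    (lam * \<Delta>\<^sup>2 * real (card S) + l1norm (vec_restrict \<beta>s (- S)))"
proof -
  define h where "h = \<beta>l - \<beta>s"
  define R where "R = l1norm (vec_restrict \<beta>s (- S))"
  define t where "t = norm (X *v h)"
  define a where "a = lam * \<Delta> * sqrt (real (card S))"
  define c where "c = (1 - lam0 / lam) - 2 * \<kappa>"
  have "lam0 < lam * (1 - 2 * \<kappa>)"
    using lam(2) \<kappa> by (simp add: pos_divide_less_eq)
  moreover have c: "lam * c = lam - lam0 - 2 * lam * \<kappa>"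
    using lam(1) by (simp add: c_def field_simps)
  ultimately have "0 < lam * c" by (simp add: algebra_simps)
  then have c0: "0 < c" using lam(1) by (simp add: zero_less_mult_iff)
  have "l1norm (vec_restrict h S) \<le> \<Delta> * sqrt (real (card S)) * t + \<kappa> * l1norm h"
    using udp S unfolding UDP_def t_def by blast
  then have "2 * lam * (l1norm (vec_restrict h S) + R)
      \<le> 2 * lam * (\<Delta> * sqrt (real (card S)) * t + \<kappa> * l1norm h + R)"
    using lam(1) by (intro mult_left_mono) auto
  moreover have "1/2 * t\<^sup>2 + (lam - lam0) * l1norm h \<le> 2 * lam * (l1norm (vec_restrict h S) + R)"
    using lasso_basic_inequality[OF y noise _ lasso] lam(1) by (simp add: h_def t_def R_def)
  ultimately have "lam * c * l1norm h \<le> 2 * a * t - 1/2 * t\<^sup>2 + 2 * lam * R"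
    unfolding c a_def by (simp add: algebra_simps)
  \<comment> \<open>The quadratic in \<open>t\<close> is largest at \<open>t = 2 * a\<close>.\<close>
  also have "2 * a * t - 1/2 * t\<^sup>2 \<le> 2 * a\<^sup>2"
    using zero_le_power2[of "t - 2 * a"] by (simp add: power2_diff power_mult_distrib algebra_simps)
  also have "a\<^sup>2 = lam * (lam * \<Delta>\<^sup>2 * real (card S))"
    by (simp add: a_def power_mult_distrib power2_eq_square[of lam])
  finally have "lam * (c * l1norm h) \<le> lam * (2 * (lam * \<Delta>\<^sup>2 * real (card S) + R))"
    by (simp add: algebra_simps)
  then have "c * l1norm h \<le> 2 * (lam * \<Delta>\<^sup>2 * real (card S) + R)"
    using lam(1) by (simp only: mult_le_cancel_left_pos)
  then show ?thesis
    using c0 unfolding c_def[symmetric] h_def[symmetric] R_def[symmetric]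
    by (simp add: pos_le_divide_eq mult.commute)
qed

section \<open>The smallest singular value as a lower bound\<close>

text \<open>Moving from \<open>u\<close> a small way in the direction \<open>- B u\<close> would make the quadratic form negative
  unless \<open>B u\<close> vanishes.\<close>

lemma psd_form_eq_0_imp_kernel:
  fixes B :: "'a::real_inner \<Rightarrow> 'a"
  assumes lin: "linear B" and sym: "\<And>x y. B x \<bullet> y = x \<bullet> B y"
    and psd: "\<And>x. 0 \<le> x \<bullet> B x" and u: "u \<bullet> B u = 0"
  shows "B u = 0"
proof (rule ccontr)
  assume g: "B u \<noteq> 0"
  define N where "N = B u \<bullet> B u"
  define c where "c = B u \<bullet> B (B u)"
  have N: "0 < N" using g by (simp add: N_def)
  have c: "0 \<le> c" unfolding c_def by (rule psd)
  \<comment> \<open>Any positive step below \<open>2 * N / c\<close> works; the added \<open>1\<close> covers \<open>c = 0\<close>.\<close>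
  define t where "t = N / (c + 1)"
  have t: "0 < t" using N c by (simp add: t_def)
  have "(u - t *\<^sub>R B u) \<bullet> B (u - t *\<^sub>R B u) = t * (c * t - 2 * N)"
    using u by (simp add: linear_diff[OF lin] linear_scale[OF lin] inner_diff_left inner_diff_right
        sym[symmetric] N_def c_def algebra_simps)
  then have "2 * N \<le> c * t"
    using psd[of "u - t *\<^sub>R B u"] t by (simp add: zero_le_mult_iff)
  also have "c * t < (c + 1) * t" using t by simp
  also have "\<dots> = N" using c by (simp add: t_def)
  finally show False using N by simp
qed

text \<open>A unit vector \<open>u\<close> that minimises \<open>\<parallel>X\<^sup>T u\<parallel>\<close>, with minimum \<open>m\<close>, is a zero of the positive
  semidefinite form of \<open>X X\<^sup>T - m\<^sup>2\<close>, so \<open>X X\<^sup>T u = m\<^sup>2 u\<close>. Full row rank makes \<open>m\<close> positive, so that \<open>u\<close> and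
  \<open>X\<^sup>T u / m\<close> are a pair of singular vectors for \<open>m\<close>, whence \<open>\<rho> \<le> m\<close>.\<close>

lemma min_singular_value_le_transpose:
  fixes X :: "real^'p^'n"
  assumes rank: "rank X = CARD('n)"
  shows "min_singular_value X * norm w \<le> norm (transpose X *v w)"
proof -
  let ?T = "\<lambda>u. transpose X *v u"
  have adj: "?T a \<bullet> b = a \<bullet> (X *v b)" for a b
    by (metis dot_lmul_matrix transpose_matrix_vector)
  have "\<exists>u\<in>sphere 0 1. \<forall>w\<in>sphere 0 1. norm (?T u) \<le> norm (?T w)"
    by (intro continuous_attains_inf continuous_on_norm linear_continuous_on
        matrix_vector_mul_bounded_linear) simp_all
  then obtain u where u: "norm u = 1" and min: "\<And>w. norm w = 1 \<Longrightarrow> norm (?T u) \<le> norm (?T w)"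
    by auto
  define m where "m = norm (?T u)"
  have ge: "m * norm w \<le> norm (?T w)" for w
  proof (cases "w = 0")
    case False
    have "m \<le> norm (?T ((1 / norm w) *\<^sub>R w))"
      unfolding m_def using False by (intro min) simp
    then show ?thesis
      using False by (simp add: matrix_vector_mult_scaleR divide_simps)
  qed simp
  define B where "B w = X *v ?T w - m\<^sup>2 *\<^sub>R w" for w
  have form: "w \<bullet> B w = (norm (?T w))\<^sup>2 - (m * norm w)\<^sup>2" for w
    by (simp add: B_def inner_diff_right adj[symmetric] power_mult_distrib power2_norm_eq_inner)
  have "B u = 0"
  proof (rule psd_form_eq_0_imp_kernel[where B = B and u = u])
    show "linear B"
      by (rule linearI)
        (simp_all add: B_def matrix_vector_right_distrib matrix_vector_mult_scaleR algebra_simps)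
    show "B x \<bullet> z = x \<bullet> B z" for x z
      unfolding B_def inner_diff_left inner_diff_right adj[symmetric]
      by (simp add: inner_commute[of "X *v _"] adj[symmetric] inner_commute)
    show "0 \<le> x \<bullet> B x" for x
      unfolding form using ge[of x] by (simp add: m_def power_mono)
    show "u \<bullet> B u = 0"
      unfolding form by (simp add: u m_def)
  qed
  then have eig: "X *v ?T u = m\<^sup>2 *\<^sub>R u" by (simp add: B_def)
  have "inj ((*v) (transpose X))"
    using rank by (simp add: full_rank_injective[symmetric] rank_transpose)
  then have "?T u \<noteq> 0"
    using u by (metis injD matrix_vector_mult_0_right norm_zero zero_neq_one)
  then have "0 < m" by (simp add: m_def)
  then have "m \<in> singular_values X"
    unfolding singular_values_def using u eig m_def
    by (intro CollectI conjI exI[of _ u] exI[of _ "(1 / m) *\<^sub>R ?T u"])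
       (auto simp: matrix_vector_mult_scaleR power2_eq_square)
  then have "min_singular_value X \<le> m"
    by (rule min_singular_value(3)[OF rank])
  then show ?thesis
    using ge[of w] mult_right_mono[of "min_singular_value X" m "norm w"] by simp
qed

text \<open>By duality the lower bound passes from \<open>X\<^sup>T\<close> to \<open>X\<close> on the range of \<open>X\<^sup>T\<close>:
  if \<open>z = X\<^sup>T w\<close>, then \<open>\<parallel>z\<parallel>\<^sup>2 = w \<bullet> X z \<le> \<parallel>w\<parallel> \<parallel>X z\<parallel>\<close>, and \<open>\<parallel>w\<parallel> \<le> \<parallel>z\<parallel> / \<rho>\<close>.\<close>

lemma norm_matrix_row_space_ge:
  fixes X :: "real^'p^'n"
  assumes rank: "rank X = CARD('n)"
  shows "min_singular_value X * norm (transpose X *v w) \<le> norm (X *v (transpose X *v w))"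
proof (cases "transpose X *v w = 0")
  case False
  let ?z = "transpose X *v w" and ?\<rho> = "min_singular_value X"
  have "(norm ?z)\<^sup>2 = w \<bullet> (X *v ?z)"
    unfolding power2_norm_eq_inner by (metis dot_lmul_matrix transpose_matrix_vector)
  also have "\<dots> \<le> norm w * norm (X *v ?z)"
    by (rule norm_cauchy_schwarz)
  finally have "?\<rho> * (norm ?z)\<^sup>2 \<le> (?\<rho> * norm w) * norm (X *v ?z)"
    using min_singular_value(2)[OF rank] by (simp add: mult.assoc mult_left_mono)
  also have "\<dots> \<le> norm ?z * norm (X *v ?z)"
    by (intro mult_right_mono min_singular_value_le_transpose rank) simp
  finally have "norm ?z * (?\<rho> * norm ?z) \<le> norm ?z * norm (X *v ?z)"
    by (simp add: power2_eq_square mult_ac)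
  then show ?thesis using False by simp
qed simp

lemma full_row_rank_obtain_kernel_decomp:
  fixes X :: "real^'p^'n"
  assumes rank: "rank X = CARD('n)"
  obtains x w where "\<gamma> = x + transpose X *v w" "X *v x = 0"
proof -
  let ?A = "\<lambda>w. X *v (transpose X *v w)"
  have lin: "linear ?A"
    using linear_compose[OF matrix_vector_mul_linear[of "transpose X"] matrix_vector_mul_linear[of X]]
    by (simp add: o_def)
  have "w = 0" if "?A w = 0" for w
  proof -
    have "min_singular_value X * norm (transpose X *v w) \<le> 0"
      using norm_matrix_row_space_ge[OF rank, of w] that by simp
    then have "norm (transpose X *v w) = 0"
      using min_singular_value(2)[OF rank] by (simp add: mult_le_0_iff)
    then have "min_singular_value X * norm w \<le> 0"
      using min_singular_value_le_transpose[OF rank, of w] by simp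
    then show ?thesis
      using min_singular_value(2)[OF rank] by (simp add: mult_le_0_iff)
  qed
  then have "surj ?A"
    using lin by (intro linear_injective_imp_surjective) (auto simp: linear_injective_0)
  then obtain w where "X *v \<gamma> = ?A w" by (metis surjD)
  then have "X *v (\<gamma> - transpose X *v w) = 0"
    by (simp add: matrix_vector_mult_diff_distrib)
  then show thesis by (intro that[of "\<gamma> - transpose X *v w" w]) simp_all
qed

section \<open>Universal distortion from the distortion of the kernel\<close>

text \<open>Split \<open>\<gamma> = x + z\<close> with \<open>x\<close> in the kernel and \<open>z\<close> in the row space. The distortion gives
  \<open>\<surd>p \<parallel>x\<parallel> \<le> \<delta> \<parallel>x\<parallel>\<^sub>1 \<le> \<delta> (\<parallel>\<gamma>\<parallel>\<^sub>1 + \<surd>p \<parallel>z\<parallel>)\<close>, so that \<open>\<parallel>\<gamma>\<parallel> \<le> (\<delta> / \<surd>p) \<parallel>\<gamma>\<parallel>\<^sub>1 + (1 + \<delta>) \<parallel>z\<parallel>\<close>. Here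
  \<open>\<parallel>z\<parallel> \<le> \<parallel>X \<gamma>\<parallel> / \<rho>\<close> and \<open>1 + \<delta> \<le> 2 \<delta>\<close>. Restricting to \<open>S\<close> costs a factor \<open>\<surd>s\<close>, and the bound on
  \<open>s\<close> says precisely that \<open>\<surd>s \<delta> / \<surd>p \<le> \<kappa>\<close>.\<close>

lemma UDP_of_distortion:
  fixes X :: "real^'p^'n"
  assumes rank: "rank X = CARD('n)"
    and dist: "has_distortion {x. X *v x = 0} \<delta>"
    and \<kappa>: "0 \<le> \<kappa>" and S0: "real S0 \<le> (\<kappa> / \<delta>)\<^sup>2 * real CARD('p)"
  shows "UDP X S0 \<kappa> (2 * \<delta> / min_singular_value X)"
  unfolding UDP_def
proof (intro allI impI)
  fix \<gamma> :: "real^'p" and s and S :: "'p set"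
  assume s: "1 \<le> s \<and> s \<le> S0" and S: "card S = s"
  let ?\<rho> = "min_singular_value X" and ?p = "sqrt (real CARD('p))"
  have \<rho>: "0 < ?\<rho>" by (rule min_singular_value(2)[OF rank])
  have \<delta>: "1 \<le> \<delta>" using dist by (simp add: has_distortion_def)
  have p: "0 < ?p" by simp
  obtain x w where \<gamma>: "\<gamma> = x + transpose X *v w" and x: "X *v x = 0"
    by (rule full_row_rank_obtain_kernel_decomp[OF rank])
  define z where "z = transpose X *v w"
  have xz: "\<gamma> = x + z" "x = \<gamma> - z" by (simp_all add: \<gamma> z_def)
  have Xz: "?\<rho> * norm z \<le> norm (X *v \<gamma>)"
    using norm_matrix_row_space_ge[OF rank, of w] x
    by (simp add: xz(1) z_def matrix_vector_right_distrib)
  have "?p * norm x \<le> \<delta> * l1norm x"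
    using dist x by (simp add: has_distortion_def)
  also have "l1norm x \<le> l1norm \<gamma> + ?p * norm z"
    unfolding xz(2) using l1norm_diff_le[of \<gamma> z] l1norm_le_norm[of z] by simp
  finally have px: "?p * norm x \<le> \<delta> * (l1norm \<gamma> + ?p * norm z)"
    using \<delta> by (simp add: mult_left_mono)
  have "?p * norm \<gamma> \<le> ?p * norm x + ?p * norm z"
    unfolding xz(1) distrib_left[symmetric] by (intro mult_left_mono norm_triangle_ineq) simp
  also have "\<dots> \<le> \<delta> * l1norm \<gamma> + (1 + \<delta>) * (?p * norm z)"
    using px by (simp add: algebra_simps)
  also have "\<dots> \<le> \<delta> * l1norm \<gamma> + 2 * \<delta> * (?p * norm z)"
    using \<delta> by (intro add_left_mono mult_right_mono) auto
  also have "norm z \<le> norm (X *v \<gamma>) / ?\<rho>"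
    using Xz \<rho> by (simp add: pos_le_divide_eq mult.commute)
  finally have "?p * norm \<gamma> \<le> \<delta> * l1norm \<gamma> + 2 * \<delta> * (?p * (norm (X *v \<gamma>) / ?\<rho>))"
    using \<delta> p by (simp add: mult_left_mono)
  also have "\<dots> = ?p * (\<delta> / ?p * l1norm \<gamma> + 2 * \<delta> / ?\<rho> * norm (X *v \<gamma>))"
    using p by (simp add: field_simps del: real_sqrt_gt_0_iff)
  finally have n\<gamma>: "norm \<gamma> \<le> \<delta> / ?p * l1norm \<gamma> + 2 * \<delta> / ?\<rho> * norm (X *v \<gamma>)"
    using p by (simp only: mult_le_cancel_left_pos)
  have "real s \<le> (\<kappa> / \<delta>)\<^sup>2 * real CARD('p)" using s S0 by linarith
  then have "sqrt (real s) \<le> sqrt ((\<kappa> / \<delta>)\<^sup>2 * real CARD('p))"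
    by (rule real_sqrt_le_mono)
  also have "\<dots> = \<kappa> / \<delta> * ?p" using \<kappa> \<delta> by (simp add: real_sqrt_mult)
  finally have s\<kappa>: "sqrt (real s) * (\<delta> / ?p) \<le> \<kappa>"
    using \<delta> by (simp add: divide_simps mult.commute)
  have "l1norm (vec_restrict \<gamma> S) \<le> sqrt (real s) * norm \<gamma>"
    using l1norm_vec_restrict_le_norm[of \<gamma> S] S by simp
  also have "\<dots> \<le> sqrt (real s) * (\<delta> / ?p * l1norm \<gamma> + 2 * \<delta> / ?\<rho> * norm (X *v \<gamma>))"
    using n\<gamma> by (intro mult_left_mono) auto
  also have "\<dots> = 2 * \<delta> / ?\<rho> * sqrt (real s) * norm (X *v \<gamma>) + sqrt (real s) * (\<delta> / ?p) * l1norm \<gamma>"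
    by (simp add: algebra_simps)
  also have "\<dots> \<le> 2 * \<delta> / ?\<rho> * sqrt (real s) * norm (X *v \<gamma>) + \<kappa> * l1norm \<gamma>"
    by (intro add_left_mono mult_right_mono s\<kappa> l1norm_nonneg)
  finally show "l1norm (vec_restrict \<gamma> S)
      \<le> 2 * \<delta> / ?\<rho> * sqrt (real s) * norm (X *v \<gamma>) + \<kappa> * l1norm \<gamma>" .
qed

section \<open>Oracle inequalities for the lasso\<close>

theorem theorem2p1:
  fixes X :: "real^'p^'n" and \<beta>s :: "real^'p" and \<epsilon> y :: "real^'n" and lam0 :: real
  assumes "CARD('n) \<le> CARD('p)"
    and "rank X = CARD('n)"
    and "y = X *v \<beta>s + \<epsilon>"
    and "infnorm (transpose X *v \<epsilon>) \<le> lam0"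
  shows "(\<forall>S0 \<kappa> \<Delta> lam \<beta>l.
            1 \<le> S0 \<and> S0 \<le> CARD('p) \<and> 0 < \<kappa> \<and> \<kappa> < 1/2 \<and> 0 < \<Delta> \<and> UDP X S0 \<kappa> \<Delta> \<and>
            0 < lam \<and> lam0 / (1 - 2 * \<kappa>) < lam \<and> lasso_estimator X y lam \<beta>l \<longrightarrow>
            l1norm (\<beta>l - \<beta>s) \<le> 2 / ((1 - lam0 / lam) - 2 * \<kappa>) *
              Min ((\<lambda>S. lam * \<Delta>\<^sup>2 * real (card S) + l1norm (vec_restrict \<beta>s (- S))) `
                     {S. 1 \<le> card S \<and> card S \<le> S0}))
       \<and> (\<forall>\<kappa> lam \<beta>l S. let \<rho> = min_singular_value X; \<delta> = distortion {x. X *v x = 0} in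
            0 < \<kappa> \<and> \<kappa> < 1/2 \<and> 0 < lam \<and> lam0 / (1 - 2 * \<kappa>) < lam \<and>
            lasso_estimator X y lam \<beta>l \<and>
            1 \<le> card S \<and> real (card S) \<le> (\<kappa> / \<delta>)\<^sup>2 * real CARD('p) \<longrightarrow>
            l1norm (\<beta>l - \<beta>s) \<le> 2 / ((1 - lam0 / lam) - 2 * \<kappa>) *
              (lam * (4 * \<delta>\<^sup>2 / \<rho>\<^sup>2) * real (card S) + l1norm (vec_restrict \<beta>s (- S))))"
proof (intro conjI allI impI)
  fix S0 \<kappa> \<Delta> lam \<beta>l
  assume A: "1 \<le> S0 \<and> S0 \<le> CARD('p) \<and> 0 < \<kappa> \<and> \<kappa> < 1/2 \<and> 0 < \<Delta> \<and> UDP X S0 \<kappa> \<Delta> \<and>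
    0 < lam \<and> lam0 / (1 - 2 * \<kappa>) < lam \<and> lasso_estimator X y lam \<beta>l"
  let ?f = "\<lambda>S. lam * \<Delta>\<^sup>2 * real (card S) + l1norm (vec_restrict \<beta>s (- S))"
  let ?F = "{S :: 'p set. 1 \<le> card S \<and> card S \<le> S0}"
  have "{undefined} \<in> ?F" using A by simp
  then have "?f ` ?F \<noteq> {}" by blast
  then have "Min (?f ` ?F) \<in> ?f ` ?F" by (intro Min_in finite_imageI) simp_all
  then obtain S where S: "1 \<le> card S" "card S \<le> S0" and eq: "Min (?f ` ?F) = ?f S" by auto
  show "l1norm (\<beta>l - \<beta>s) \<le> 2 / ((1 - lam0 / lam) - 2 * \<kappa>) * Min (?f ` ?F)"
    unfolding eq using A S by (intro lasso_error_le[OF assms(3,4)]) auto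
next
  fix \<kappa> lam \<beta>l and S :: "'p set"
  let ?\<rho> = "min_singular_value X" and ?\<delta> = "distortion {x. X *v x = 0}"
  show "let \<rho> = ?\<rho>; \<delta> = ?\<delta> in
    0 < \<kappa> \<and> \<kappa> < 1/2 \<and> 0 < lam \<and> lam0 / (1 - 2 * \<kappa>) < lam \<and>
    lasso_estimator X y lam \<beta>l \<and>
    1 \<le> card S \<and> real (card S) \<le> (\<kappa> / \<delta>)\<^sup>2 * real CARD('p) \<longrightarrow>
    l1norm (\<beta>l - \<beta>s) \<le> 2 / ((1 - lam0 / lam) - 2 * \<kappa>) *
      (lam * (4 * \<delta>\<^sup>2 / \<rho>\<^sup>2) * real (card S) + l1norm (vec_restrict \<beta>s (- S)))"
    unfolding Let_def
  proof (intro impI)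
    assume A: "0 < \<kappa> \<and> \<kappa> < 1/2 \<and> 0 < lam \<and> lam0 / (1 - 2 * \<kappa>) < lam \<and>
      lasso_estimator X y lam \<beta>l \<and>
      1 \<le> card S \<and> real (card S) \<le> (\<kappa> / ?\<delta>)\<^sup>2 * real CARD('p)"
    then have udp: "UDP X (card S) \<kappa> (2 * ?\<delta> / ?\<rho>)"
      by (intro UDP_of_distortion[OF assms(2) has_distortion_distortion]) auto
    have sq: "4 * ?\<delta>\<^sup>2 / ?\<rho>\<^sup>2 = (2 * ?\<delta> / ?\<rho>)\<^sup>2"
      by (simp add: power_mult_distrib power_divide)
    show "l1norm (\<beta>l - \<beta>s) \<le> 2 / ((1 - lam0 / lam) - 2 * \<kappa>) *
        (lam * (4 * ?\<delta>\<^sup>2 / ?\<rho>\<^sup>2) * real (card S) + l1norm (vec_restrict \<beta>s (- S)))"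
      unfolding sq using A by (intro lasso_error_le[OF assms(3,4) _ _ _ _ udp]) auto
  qed
qed

end
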